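(* Let $\gamma\in[0,1)$, let $(\mathbf{d}(0),\mathbf{d}(1))$ be a probability vector, put $\mathbf{d}^\gamma_s=(1-\gamma)\mathbf{d}(s)$ for $s\in\{0,1\}$, and let $p_0,p_1\in[0,1]$ with $p_0,p_1\ge\frac12$. Define $$b_l=2\max\{(1-\gamma p_0-\mathbf{d}^\gamma_0)(p_1-p_0),\ (\mathbf{d}^\gamma_0+\gamma p_1)(p_0-p_1)\},$$ $$b_h=(2\mathbf{d}^\gamma_0+\gamma)(p_0-p_1)+2p_1-1,\qquad M=\frac{1}{1-\gamma p_0+\gamma p_1},$$ $$\eta_0^{-}(b)=\frac{\frac b2(1+\gamma p_1)-p_0(\mathbf{d}^\gamma_0+\gamma p_1)}{-(\gamma p_1+\mathbf{d}^\gamma_0)+\gamma\frac b2},\qquad \eta_1^{-}(b)=\frac{\frac b2(1-\gamma p_0)-p_1(1-\gamma p_0-\mathbf{d}^\gamma_0)}{-(1-\gamma p_0-\mathbf{d}^\gamma_0)-\gamma\frac b2}.$$ Then for every $b\ge 0$, an optimal policy for the problem $\mathbf{P1}$ (defined in the context) with cost budget $b$ is the deterministic stationary policy that chooses action $a_s$ in state $s\in\{0,1\}$, where: 1. if $b\in[0,b_l)$: $a_0=p_0$ and $a_1=\eta_1^{-}(b)$ when $|\frac12-p_1|\ge|\frac12-p_0|$; and $a_0=\eta_0^{-}(b)$ and $a_1=p_1$ when $|\frac12-p_1|<|\frac12-p_0|$; 2. if $b\in[b_l,b_h)$: $a_0=a_1=-M\left(\frac b2-\mathbf{d}^\gamma_0p_0-(1-\mathbf{d}^\gamma_0)p_1\right)$;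 3. if $b\in[b_h,\infty)$: $a_0=a_1=\frac12$.
   Context: This is a two-state constrained Markov decision process with states $\{0,1\}$, action set $[0,1]$ (action $a$ moves to state $0$ with probability $a$ and to state $1$ with probability $1-a$, whatever the current state), discount factor $\gamma$, initial distribution $\mathbf{d}$, reward $H(a)$ and cost $\mathrm{TV}_s(a)$. Notation: $H(a)=-a\log a-(1-a)\log(1-a)$ is the binary entropy function (with $0\log 0=0$), and $\mathrm{TV}_s(a)=|a-p_s|+|(1-a)-(1-p_s)|=2|a-p_s|$. Problem $\mathbf{P1}$. The variables are two finite nonnegative Borel measures $d(0,\cdot),d(1,\cdot)$ on $[0,1]$ (discounted state-action occupancy measures; point masses are allowed, and one writes $d(s,a)\,da$ for integration against $d(s,\cdot)$). Maximize $$\sum_{s=0}^1\int_0^1 H(a)\,d(s,a)\,da$$ subject to $$\int_0^1\Big(d(0,a)-\sum_{s=0}^1\gamma a\,d(s,a)\Big)da=\mathbf{d}^\gamma_0,$$ $$\int_0^1\Big(d(1,a)-\sum_{s=0}^1\gamma(1-a)\,d(s,a)\Big)da=\mathbf{d}^\gamma_1,$$ $$\sum_{s=0}^1\int_0^1\mathrm{TV}_s(a)\,d(s,a)\,da\le b .$$ The deterministic stationary policy choosing $a_s\in[0,1]$ in state $s$ has occupancy measure $d(s,\cdot)=d_s\,\delta_{a_s}$ (Dirac mass at $a_s$), with $$d_0=\frac{\mathbf{d}^\gamma_0+\gamma a_1}{1-\gamma a_0+\gamma a_1},\qquad d_1=1-d_0=\frac{1-\gamma a_0-\mathbf{d}^\gamma_0}{1-\gamma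 a_0+\gamma a_1}.$$ The policy is called optimal if this occupancy measure is feasible for $\mathbf{P1}$ and attains the maximum of the objective of $\mathbf{P1}$. *)

theory Defs
  imports "HOL-Probability.Probability"
begin

text \<open>
  The two states are the natural numbers 0 and 1; functions on states (initial distribution,
  default policy, occupancy measures) have type \<^typ>\<open>nat \<Rightarrow> _\<close> and only their values
  at 0 and 1 matter.
\<close>

abbreviation action_space :: "real measure" where
  "action_space \<equiv> restrict_space borel {0..1}"

text \<open>Since \<^prop>\<open>ln (0::real) = 0\<close>, the convention on \<open>0 log 0\<close> is built in.\<close>

definition bin_entropy :: "real \<Rightarrow> real" where
  "bin_entropy a = - a * ln a - (1 - a) * ln (1 - a)"

definition TV :: "(nat \<Rightarrow> real) \<Rightarrow> nat \<Rightarrow> real \<Rightarrow> real" where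
  "TV p s a = \<bar>a - p s\<bar> + \<bar>(1 - a) - (1 - p s)\<bar>"

definition disc_init :: "real \<Rightarrow> (nat \<Rightarrow> real) \<Rightarrow> nat \<Rightarrow> real" where
  "disc_init \<gamma> d s = (1 - \<gamma>) * d s"

definition P1_objective :: "(nat \<Rightarrow> real measure) \<Rightarrow> real" where
  "P1_objective D = (\<Sum>s\<in>{0,1}. \<integral>a. bin_entropy a \<partial>D s)"

text \<open>
  All integrands below are bounded and measurable on \<open>[0,1]\<close>, so for finite measures the
  Bochner integrals are genuine; \<open>\<integral>a. 1 \<partial>D s\<close> is the total mass of \<open>D s\<close>.
\<close>

definition P1_feasible ::
  "real \<Rightarrow> (nat \<Rightarrow> real) \<Rightarrow> (nat \<Rightarrow> real) \<Rightarrow> real \<Rightarrow> (nat \<Rightarrow> real measure) \<Rightarrow> bool" where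
  "P1_feasible \<gamma> d p b D \<longleftrightarrow>
     (\<forall>s\<in>{0,1}. finite_measure (D s) \<and> sets (D s) = sets action_space) \<and>
     (\<integral>a. 1 \<partial>D 0) - (\<Sum>s\<in>{0,1}. \<integral>a. \<gamma> * a \<partial>D s) = disc_init \<gamma> d 0 \<and>
     (\<integral>a. 1 \<partial>D 1) - (\<Sum>s\<in>{0,1}. \<integral>a. \<gamma> * (1 - a) \<partial>D s) = disc_init \<gamma> d 1 \<and>
     (\<Sum>s\<in>{0,1}. \<integral>a. TV p s a \<partial>D s) \<le> b"

definition P1_optimal ::
  "real \<Rightarrow> (nat \<Rightarrow> real) \<Rightarrow> (nat \<Rightarrow> real) \<Rightarrow> real \<Rightarrow> (nat \<Rightarrow> real measure) \<Rightarrow> bool" where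
  "P1_optimal \<gamma> d p b D \<longleftrightarrow>
     P1_feasible \<gamma> d p b D \<and>
     (\<forall>D'. P1_feasible \<gamma> d p b D' \<longrightarrow> P1_objective D' \<le> P1_objective D)"

definition policy_mass0 :: "real \<Rightarrow> (nat \<Rightarrow> real) \<Rightarrow> real \<Rightarrow> real \<Rightarrow> real" where
  "policy_mass0 \<gamma> d a0 a1 = (disc_init \<gamma> d 0 + \<gamma> * a1) / (1 - \<gamma> * a0 + \<gamma> * a1)"

text \<open>
  For \<open>a0, a1\<close> in \<open>[0,1]\<close> and \<open>d\<close> a probability vector, the mass in
  state 0 lies in \<open>[0,1]\<close>, so \<^const>\<open>ennreal\<close> does not truncate.
\<close>

definition policy_occupancy ::
  "real \<Rightarrow> (nat \<Rightarrow> real) \<Rightarrow> real \<Rightarrow> real \<Rightarrow> nat \<Rightarrow> real measure" where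
  "policy_occupancy \<gamma> d a0 a1 s =
     (if s = 0 then scale_measure (ennreal (policy_mass0 \<gamma> d a0 a1)) (return action_space a0)
      else scale_measure (ennreal (1 - policy_mass0 \<gamma> d a0 a1)) (return action_space a1))"

definition optimal_policy ::
  "real \<Rightarrow> (nat \<Rightarrow> real) \<Rightarrow> (nat \<Rightarrow> real) \<Rightarrow> real \<Rightarrow> real \<Rightarrow> real \<Rightarrow> bool" where
  "optimal_policy \<gamma> d p b a0 a1 \<longleftrightarrow>
     a0 \<in> {0..1} \<and> a1 \<in> {0..1} \<and> P1_optimal \<gamma> d p b (policy_occupancy \<gamma> d a0 a1)"

definition b_low :: "real \<Rightarrow> (nat \<Rightarrow> real) \<Rightarrow> (nat \<Rightarrow> real) \<Rightarrow> real" where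
  "b_low \<gamma> d p =
     2 * max ((1 - \<gamma> * p 0 - disc_init \<gamma> d 0) * (p 1 - p 0))
             ((disc_init \<gamma> d 0 + \<gamma> * p 1) * (p 0 - p 1))"

definition b_high :: "real \<Rightarrow> (nat \<Rightarrow> real) \<Rightarrow> (nat \<Rightarrow> real) \<Rightarrow> real" where
  "b_high \<gamma> d p = (2 * disc_init \<gamma> d 0 + \<gamma>) * (p 0 - p 1) + 2 * p 1 - 1"

definition M_coeff :: "real \<Rightarrow> (nat \<Rightarrow> real) \<Rightarrow> real" where
  "M_coeff \<gamma> p = 1 / (1 - \<gamma> * p 0 + \<gamma> * p 1)"

definition eta0_minus :: "real \<Rightarrow> (nat \<Rightarrow> real) \<Rightarrow> (nat \<Rightarrow> real) \<Rightarrow> real \<Rightarrow> real" where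
  "eta0_minus \<gamma> d p b =
     (b / 2 * (1 + \<gamma> * p 1) - p 0 * (disc_init \<gamma> d 0 + \<gamma> * p 1)) /
     (- (\<gamma> * p 1 + disc_init \<gamma> d 0) + \<gamma> * (b / 2))"

definition eta1_minus :: "real \<Rightarrow> (nat \<Rightarrow> real) \<Rightarrow> (nat \<Rightarrow> real) \<Rightarrow> real \<Rightarrow> real" where
  "eta1_minus \<gamma> d p b =
     (b / 2 * (1 - \<gamma> * p 0) - p 1 * (1 - \<gamma> * p 0 - disc_init \<gamma> d 0)) /
     (- (1 - \<gamma> * p 0 - disc_init \<gamma> d 0) - \<gamma> * (b / 2))"

end

theory Submission
  imports Defs
begin

text \<open>
  Lagrangian duality. If multipliers \<open>l \<ge> 0\<close> (budget), \<open>\<mu>\<close> (balance in state 0) and \<open>\<nu>\<close> (total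
  mass, which is 1) satisfy \<open>H(a) \<le> l \<bar>a - p\<^sub>s\<bar> - \<mu> \<gamma> a + \<mu> [s = 0] + \<nu>\<close> pointwise, integration bounds
  the objective by \<open>l b/2 + \<mu> d\<^sup>\<gamma>\<^sub>0 + \<nu>\<close>. As \<open>H\<close> is concave, a policy with actions inside \<open>(0,1)\<close>
  attains this bound as soon as \<open>\<mu> \<gamma> + H'(a\<^sub>s)\<close> is a subgradient of \<open>a \<mapsto> l \<bar>a - p\<^sub>s\<bar>\<close> at \<open>a\<^sub>s\<close>, and
  the two state values agree. For \<open>b > 0\<close> such multipliers are explicit in every case. For \<open>b = 0\<close>
  the multiplier \<open>l\<close> may be infinite, but then every feasible pair of measures is concentrated
  at \<open>p\<^sub>0\<close> and \<open>p\<^sub>1\<close>.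
\<close>

section \<open>Binary entropy\<close>

text \<open>The negative derivative of \<open>bin_entropy\<close>: the tangent at \<open>a\<close>
  has slope \<open>- logit a\<close>.\<close>

definition logit :: "real \<Rightarrow> real" where
  "logit a = ln a - ln (1 - a)"

lemma logit_mono:
  assumes "0 < a" "a \<le> b" "b < 1"
  shows "logit a \<le> logit b"
  using assms by (auto simp: logit_def intro!: diff_mono)

lemma logit_nonneg:
  assumes "1/2 \<le> a" "a < 1"
  shows "0 \<le> logit a"
  using assms by (simp add: logit_def)

text \<open>This is \<open>ln t \<le> t - 1\<close> at \<open>t = a / x\<close>, multiplied by
  \<open>x\<close>; at \<open>x = 0\<close> both products vanish.\<close>

lemma mult_ln_diff_le:
  assumes "0 \<le> x" "0 < (a::real)"
  shows "x * ln a - x * ln x \<le> a - x"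
proof (cases "x = 0")
  case False
  with assms have "x > 0" by simp
  have "x * ln (a / x) \<le> x * (a / x - 1)"
    using \<open>x > 0\<close> \<open>0 < a\<close> by (intro mult_left_mono ln_le_minus_one) auto
  then show ?thesis
    using \<open>x > 0\<close> \<open>0 < a\<close> by (simp add: ln_div right_diff_distrib)
qed (use assms in simp)

text \<open>Concavity without calculus: \<open>mult_ln_diff_le\<close> is applied to
  \<open>x\<close> and to \<open>1 - x\<close>, and the two right-hand sides cancel. Only the point
  of tangency has to be interior; \<open>x\<close> may be an endpoint.\<close>

lemma bin_entropy_le_tangent:
  assumes "x \<in> {0..1}" "0 < a" "a < 1"
  shows "bin_entropy x \<le> bin_entropy a - logit a * (x - a)"
proof -
  have "x * ln a - x * ln x \<le> a - x"
    using assms by (intro mult_ln_diff_le) auto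
  moreover have "(1 - x) * ln (1 - a) - (1 - x) * ln (1 - x) \<le> (1 - a) - (1 - x)"
    using assms by (intro mult_ln_diff_le) auto
  ultimately show ?thesis
    by (simp add: bin_entropy_def logit_def algebra_simps)
qed

lemma bin_entropy_le_ln2:
  assumes "x \<in> {0..1}"
  shows "bin_entropy x \<le> bin_entropy (1/2)"
  using bin_entropy_le_tangent[OF assms, of "1/2"] by (simp add: logit_def)

lemma bin_entropy_nonneg:
  assumes "x \<in> {0..1}"
  shows "0 \<le> bin_entropy x"
proof -
  have "y * ln y \<le> 0" if "y \<in> {0..1}" for y :: real
    using that by (cases "y = 0") (auto intro!: mult_nonneg_nonpos)
  from this[of x] this[of "1 - x"] assms show ?thesis
    by (simp add: bin_entropy_def)
qed

lemma borel_measurable_bin_entropy [measurable]: "bin_entropy \<in> borel_measurable borel"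
  unfolding bin_entropy_def[abs_def] by measurable

section \<open>Integration over occupancy measures\<close>

lemma TV_eq: "TV p s a = 2 * \<bar>a - p s\<bar>"
  by (simp add: TV_def abs_if)

lemma
  fixes M :: "real measure"
  assumes "finite_measure M" "sets M = sets action_space"
  shows space_occupancy: "space M = {0..1}"
    and borel_measurable_occupancy: "(f :: real \<Rightarrow> real) \<in> borel_measurable borel \<Longrightarrow> f \<in> borel_measurable M"
    and integrable_ident_occupancy: "integrable M (\<lambda>a. a)"
    and integrable_dist_occupancy: "integrable M (\<lambda>a. \<bar>a - q\<bar>)"
    and integrable_bin_entropy_occupancy: "integrable M bin_entropy"
proof -
  interpret finite_measure M by fact
  show space: "space M = {0..1}"
    using sets_eq_imp_space_eq[OF assms(2)] by (simp add: space_restrict_space)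
  show meas: "f \<in> borel_measurable M" if "f \<in> borel_measurable borel" for f :: "real \<Rightarrow> real"
    using measurable_restrict_space1[OF that] measurable_cong_sets[OF assms(2) refl] by blast
  show "integrable M (\<lambda>a. a)"
    by (rule integrable_const_bound[where B = 1]) (auto simp: space intro!: AE_I2 meas)
  show "integrable M (\<lambda>a. \<bar>a - q\<bar>)"
    by (rule integrable_const_bound[where B = "1 + \<bar>q\<bar>"]) (auto simp: space intro!: AE_I2 meas)
  show "integrable M bin_entropy"
    by (rule integrable_const_bound[where B = "bin_entropy (1/2)"])
       (auto simp: space bin_entropy_nonneg bin_entropy_le_ln2 intro!: AE_I2 meas)
qed

lemma integral_concentrated:
  fixes f :: "real \<Rightarrow> real"
  assumes "AE a in M. a = q" "f \<in> borel_measurable M"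
  shows "(\<integral>a. f a \<partial>M) = measure M (space M) * f q"
proof -
  have "(\<integral>a. f a \<partial>M) = (\<integral>a. f q \<partial>M)"
    using assms by (intro integral_cong_AE) auto
  then show ?thesis by simp
qed

text \<open>The constraints see the measures only through masses, first moments and mean distances
  to \<open>p s\<close>. As \<open>TV\<close> is twice the distance, the budget becomes
  \<open>b / 2\<close>.\<close>

lemma P1_feasible_iff:
  assumes "\<And>s. s \<in> {0, 1} \<Longrightarrow> finite_measure (D s)"
    and "\<And>s. s \<in> {0, 1} \<Longrightarrow> sets (D s) = sets action_space"
  defines "m \<equiv> \<lambda>s. measure (D s) (space (D s))"
    and "E \<equiv> (\<integral>a. a \<partial>D 0) + (\<integral>a. a \<partial>D 1)"
  shows "P1_feasible \<gamma> d p b D \<longleftrightarrow>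
    m 0 - \<gamma> * E = disc_init \<gamma> d 0 \<and>
    m 1 - \<gamma> * (m 0 + m 1 - E) = disc_init \<gamma> d 1 \<and>
    (\<integral>a. \<bar>a - p 0\<bar> \<partial>D 0) + (\<integral>a. \<bar>a - p 1\<bar> \<partial>D 1) \<le> b / 2"
proof -
  have int: "integrable (D s) (\<lambda>a. a)" if "s \<in> {0, 1}" for s
    using integrable_ident_occupancy assms that by blast
  have compl: "(\<integral>a. 1 - a \<partial>D s) = m s - (\<integral>a. a \<partial>D s)" if "s \<in> {0, 1}" for s
    using int[OF that] finite_measure.integrable_const[OF assms(1)[OF that]]
    by (subst Bochner_Integration.integral_diff) (auto simp: m_def)
  have "(\<Sum>s\<in>{0,1}. \<integral>a. \<gamma> * a \<partial>D s) = \<gamma> * E"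
    by (simp add: E_def distrib_left)
  moreover have "(\<Sum>s\<in>{0,1}. \<integral>a. \<gamma> * (1 - a) \<partial>D s) = \<gamma> * (m 0 + m 1 - E)"
  proof -
    have "(\<Sum>s\<in>{0,1}. \<integral>a. \<gamma> * (1 - a) \<partial>D s) =
        \<gamma> * (m 0 - (\<integral>a. a \<partial>D 0)) + \<gamma> * (m 1 - (\<integral>a. a \<partial>D 1))"
      using compl[of 0] compl[of 1] by simp
    also have "\<dots> = \<gamma> * (m 0 + m 1 - E)"
      by (simp add: E_def algebra_simps)
    finally show ?thesis .
  qed
  moreover have "(\<Sum>s\<in>{0,1}. \<integral>a. TV p s a \<partial>D s) =
      2 * ((\<integral>a. \<bar>a - p 0\<bar> \<partial>D 0) + (\<integral>a. \<bar>a - p 1\<bar> \<partial>D 1))"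
    by (simp add: TV_eq)
  moreover have "(\<integral>a. 1 \<partial>D s) = m s" for s
    by (simp add: m_def)
  ultimately show ?thesis
    unfolding P1_feasible_def using assms(1,2) by auto
qed

section \<open>Total mass and weak duality\<close>

lemma P1_feasible_finite:
  assumes "P1_feasible \<gamma> d p b D" "s \<in> {0, 1}"
  shows "finite_measure (D s)" "sets (D s) = sets action_space"
  using assms unfolding P1_feasible_def by blast+

text \<open>Adding the two balance equations cancels the first moments and leaves the factor
  \<open>1 - \<gamma>\<close>, which is nonzero.\<close>

lemma P1_feasible_total_mass:
  assumes "P1_feasible \<gamma> d p b D" "\<gamma> < 1" "d 0 + d 1 = 1"
  shows "measure (D 0) (space (D 0)) + measure (D 1) (space (D 1)) = 1"
proof -
  have "(1 - \<gamma>) * (measure (D 0) (space (D 0)) + measure (D 1) (space (D 1)))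
      = (1 - \<gamma>) * (d 0 + d 1)"
    using assms(1) P1_feasible_iff[of D, OF P1_feasible_finite[OF assms(1)]]
    by (simp add: disc_init_def algebra_simps)
  then show ?thesis using assms by simp
qed

text \<open>The balance of state 1 enters only through the total mass, so \<open>\<mu>\<close> is
  charged to state 0 alone. The budget is an inequality, hence \<open>0 \<le> l\<close>;
  \<open>\<mu>\<close> and \<open>\<nu>\<close> belong to equations and have free sign.\<close>

lemma P1_weak_duality:
  assumes feas: "P1_feasible \<gamma> d p b D" and "\<gamma> < 1" "d 0 + d 1 = 1" and "0 \<le> l"
    and le: "\<And>s a. s \<in> {0, 1} \<Longrightarrow> a \<in> {0..1} \<Longrightarrow>
      bin_entropy a \<le> l * \<bar>a - p s\<bar> - \<mu> * \<gamma> * a + (if s = 0 then \<mu> else 0) + \<nu>"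
  shows "P1_objective D \<le> l * (b / 2) + \<mu> * disc_init \<gamma> d 0 + \<nu>"
proof -
  note fin = P1_feasible_finite[OF feas]
  define m where "m s = measure (D s) (space (D s))" for s
  have bound: "(\<integral>a. bin_entropy a \<partial>D s) \<le> l * (\<integral>a. \<bar>a - p s\<bar> \<partial>D s) - \<mu> * \<gamma> * (\<integral>a. a \<partial>D s)
      + ((if s = 0 then \<mu> else 0) + \<nu>) * m s" if s: "s \<in> {0, 1}" for s
  proof -
    interpret finite_measure "D s" using fin s by blast
    note [simp] = integrable_ident_occupancy[OF fin[OF s]] integrable_dist_occupancy[OF fin[OF s]]
    have "(\<integral>a. bin_entropy a \<partial>D s)
        \<le> (\<integral>a. l * \<bar>a - p s\<bar> - \<mu> * \<gamma> * a + ((if s = 0 then \<mu> else 0) + \<nu>) \<partial>D s)"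
      using le[OF s] space_occupancy[OF fin[OF s]]
      by (intro integral_mono integrable_bin_entropy_occupancy[OF fin[OF s]]) (auto simp: add.assoc)
    also have "\<dots> = l * (\<integral>a. \<bar>a - p s\<bar> \<partial>D s) - \<mu> * \<gamma> * (\<integral>a. a \<partial>D s)
        + ((if s = 0 then \<mu> else 0) + \<nu>) * m s"
      by (simp add: m_def)
    finally show ?thesis .
  qed
  have budget: "(\<integral>a. \<bar>a - p 0\<bar> \<partial>D 0) + (\<integral>a. \<bar>a - p 1\<bar> \<partial>D 1) \<le> b / 2"
    and balance: "m 0 - \<gamma> * ((\<integral>a. a \<partial>D 0) + (\<integral>a. a \<partial>D 1)) = disc_init \<gamma> d 0"
    using feas P1_feasible_iff[of D, OF fin] by (auto simp: m_def)
  have mass: "m 0 + m 1 = 1"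
    using P1_feasible_total_mass[OF feas] assms by (simp add: m_def)
  \<comment> \<open>The integrated bounds of both states are regrouped so that each multiplier
    stands at its own constraint.\<close>
  have "P1_objective D \<le> l * ((\<integral>a. \<bar>a - p 0\<bar> \<partial>D 0) + (\<integral>a. \<bar>a - p 1\<bar> \<partial>D 1))
      + \<mu> * (m 0 - \<gamma> * ((\<integral>a. a \<partial>D 0) + (\<integral>a. a \<partial>D 1))) + \<nu> * (m 0 + m 1)"
    using bound[of 0] bound[of 1] by (simp add: P1_objective_def algebra_simps)
  also have "\<dots> \<le> l * (b / 2) + \<mu> * disc_init \<gamma> d 0 + \<nu>"
    unfolding balance mass using mult_left_mono[OF budget \<open>0 \<le> l\<close>] by simp
  finally show ?thesis .
qed

section \<open>Stationary deterministic policies\<close>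

lemma AE_scale_return:
  assumes "q \<in> {0..1}"
  shows "AE a in scale_measure r (return action_space q). a = q"
proof (rule AE_I')
  have "{0..1} - {q} \<in> sets action_space"
    by (auto simp: sets_restrict_space_iff)
  then show "{0..1} - {q} \<in> null_sets (scale_measure r (return action_space q))"
    by (auto simp: null_sets_def)
qed (auto simp: space_scale_measure space_restrict_space)

text \<open>The value is at least \<open>1 - \<gamma>\<close>. At \<open>p 0\<close>,
  \<open>p 1\<close> it is the denominator of \<open>M_coeff\<close>.\<close>

lemma policy_denominator_pos:
  fixes \<gamma> a0 a1 :: real
  assumes "0 \<le> \<gamma>" "\<gamma> < 1" "a0 \<in> {0..1}" "a1 \<in> {0..1}"
  shows "0 < 1 - \<gamma> * a0 + \<gamma> * a1"
proof -
  have "\<gamma> * a0 \<le> \<gamma>" "0 \<le> \<gamma> * a1"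
    using assms by (auto simp: mult_left_le)
  then show ?thesis using assms by linarith
qed

lemma policy_mass0_bounds:
  assumes "0 \<le> \<gamma>" "\<gamma> < 1" "0 \<le> d 0" "0 \<le> d 1" "d 0 + d 1 = 1" "a0 \<in> {0..1}" "a1 \<in> {0..1}"
  shows "policy_mass0 \<gamma> d a0 a1 \<in> {0..1}"
proof -
  have "\<gamma> * a0 \<le> \<gamma>" "0 \<le> \<gamma> * a1" "(1 - \<gamma>) * d 0 \<le> 1 - \<gamma>" "0 \<le> (1 - \<gamma>) * d 0"
    using assms by (auto simp: mult_left_le)
  then have "0 \<le> disc_init \<gamma> d 0 + \<gamma> * a1" "disc_init \<gamma> d 0 + \<gamma> * a1 \<le> 1 - \<gamma> * a0 + \<gamma> * a1"
    unfolding disc_init_def by linarith+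
  then show ?thesis
    using policy_denominator_pos[of \<gamma> a0 a1] assms by (simp add: policy_mass0_def)
qed

text \<open>\<open>policy_mass0\<close> solves the balance equations for point masses, so only the
  budget restricts a policy.\<close>

lemma
  assumes "0 \<le> \<gamma>" "\<gamma> < 1" "0 \<le> d 0" "0 \<le> d 1" "d 0 + d 1 = 1" "a0 \<in> {0..1}" "a1 \<in> {0..1}"
  defines "m \<equiv> policy_mass0 \<gamma> d a0 a1"
  shows policy_feasible_iff: "P1_feasible \<gamma> d p b (policy_occupancy \<gamma> d a0 a1) \<longleftrightarrow>
      m * \<bar>a0 - p 0\<bar> + (1 - m) * \<bar>a1 - p 1\<bar> \<le> b / 2"
    and policy_objective: "P1_objective (policy_occupancy \<gamma> d a0 a1) =
      m * bin_entropy a0 + (1 - m) * bin_entropy a1"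
proof -
  let ?D = "policy_occupancy \<gamma> d a0 a1"
  have m: "0 \<le> m" "m \<le> 1"
    using policy_mass0_bounds[OF assms(1-7)] by (auto simp: m_def)
  have sets: "sets (?D s) = sets action_space" for s
    by (simp add: policy_occupancy_def)
  have space: "space (?D s) = {0..1}" for s
    by (simp add: policy_occupancy_def space_scale_measure space_restrict_space)
  have in_sets: "{0..1} \<in> sets action_space"
    by (simp add: sets_restrict_space_iff)
  have emeas: "emeasure (?D s) {0..1} = ennreal (if s = 0 then m else 1 - m)" for s
    using assms(6,7) in_sets by (simp add: policy_occupancy_def m_def)
  have meas: "measure (?D 0) {0..1} = m" "measure (?D (Suc 0)) {0..1} = 1 - m"
    using emeas[of 0] emeas[of 1] m by (simp_all add: measure_def)
  have fin: "finite_measure (?D s)" for s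
    by (rule finite_measureI) (simp add: space emeas)
  have AE: "AE a in ?D 0. a = a0" "AE a in ?D (Suc 0). a = a1"
    unfolding policy_occupancy_def using assms(6,7) by (auto intro: AE_scale_return)
  have integral: "(\<integral>a. f a \<partial>?D 0) = m * f a0" "(\<integral>a. f a \<partial>?D (Suc 0)) = (1 - m) * f a1"
    if "f \<in> borel_measurable borel" for f :: "real \<Rightarrow> real"
    using integral_concentrated[OF AE(1), of f] integral_concentrated[OF AE(2), of f]
      borel_measurable_occupancy[OF fin sets that] by (simp_all add: space meas)
  have "m * (1 - \<gamma> * a0 + \<gamma> * a1) = disc_init \<gamma> d 0 + \<gamma> * a1"
    using policy_denominator_pos[of \<gamma> a0 a1] assms(1-7) by (simp add: m_def policy_mass0_def)
  then have balance0: "m - \<gamma> * (m * a0 + (1 - m) * a1) = disc_init \<gamma> d 0"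
    by (simp add: algebra_simps)
  \<comment> \<open>The discounted initial masses sum to \<open>1 - \<gamma>\<close>, which turns
    the state 0 balance into that of state 1.\<close>
  have "disc_init \<gamma> d 1 = (1 - \<gamma>) - disc_init \<gamma> d 0"
    using \<open>d 0 + d 1 = 1\<close> by (metis add_diff_cancel_left' disc_init_def mult.right_neutral right_diff_distrib)
  with balance0 have balance1:
    "(1 - m) - \<gamma> * (1 - (m * a0 + (1 - m) * a1)) = disc_init \<gamma> d 1"
    by (simp add: algebra_simps)
  show "P1_feasible \<gamma> d p b ?D \<longleftrightarrow> m * \<bar>a0 - p 0\<bar> + (1 - m) * \<bar>a1 - p 1\<bar> \<le> b / 2"
    using balance0 balance1
    by (subst P1_feasible_iff[OF fin sets]) (simp add: integral space meas)
  show "P1_objective ?D = m * bin_entropy a0 + (1 - m) * bin_entropy a1"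
    by (simp add: P1_objective_def integral)
qed

text \<open>With zero budget both mean distances vanish, so each measure is concentrated at its
  \<open>p s\<close>. Balance then fixes the masses, and all feasible pairs share one objective
  value.\<close>

lemma zero_budget_objective:
  assumes feas: "P1_feasible \<gamma> d p 0 D" and "0 \<le> \<gamma>" "\<gamma> < 1" "d 0 + d 1 = 1"
    and "p 0 \<in> {0..1}" "p 1 \<in> {0..1}"
  defines "m \<equiv> policy_mass0 \<gamma> d (p 0) (p 1)"
  shows "P1_objective D = m * bin_entropy (p 0) + (1 - m) * bin_entropy (p 1)"
proof -
  note fin = P1_feasible_finite[OF feas]
  have budget: "(\<integral>a. \<bar>a - p 0\<bar> \<partial>D 0) + (\<integral>a. \<bar>a - p 1\<bar> \<partial>D 1) \<le> 0"
    using feas P1_feasible_iff[of D, OF fin] by auto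
  have AE: "AE a in D s. a = p s" if s: "s \<in> {0, 1}" for s
  proof -
    have nonneg: "0 \<le> (\<integral>a. \<bar>a - p t\<bar> \<partial>D t)" for t
      by (rule Bochner_Integration.integral_nonneg) simp
    have "(\<integral>a. \<bar>a - p 0\<bar> \<partial>D 0) = 0" "(\<integral>a. \<bar>a - p 1\<bar> \<partial>D 1) = 0"
      using budget nonneg[of 0] nonneg[of 1] by linarith+
    with s have "(\<integral>a. \<bar>a - p s\<bar> \<partial>D s) = 0"
      by auto
    then show ?thesis
      using integral_nonneg_eq_0_iff_AE[OF integrable_dist_occupancy[OF fin[OF s]]] by simp
  qed
  define c where "c s = measure (D s) (space (D s))" for s
  have integral: "(\<integral>a. f a \<partial>D s) = c s * f (p s)"
    if "f \<in> borel_measurable borel" "s \<in> {0, 1}" for f :: "real \<Rightarrow> real" and s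
    unfolding c_def
    by (intro integral_concentrated AE[OF that(2)] borel_measurable_occupancy[OF fin[OF that(2)] that(1)])
  have balance: "c 0 - \<gamma> * (c 0 * p 0 + c 1 * p 1) = disc_init \<gamma> d 0"
    using feas P1_feasible_iff[of D, OF fin] by (simp add: integral c_def[symmetric])
  have c1: "c 1 = 1 - c 0"
    using P1_feasible_total_mass[OF feas] assms by (simp add: c_def)
  have "c 0 * (1 - \<gamma> * p 0 + \<gamma> * p 1) = disc_init \<gamma> d 0 + \<gamma> * p 1"
    using balance unfolding c1 by (simp add: algebra_simps)
  then have "c 0 = m"
    using policy_denominator_pos[of \<gamma> "p 0" "p 1"] assms
    by (simp add: m_def policy_mass0_def eq_divide_eq)
  with c1 show ?thesis
    by (simp add: P1_objective_def integral)
qed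

text \<open>The objective is constant on the feasible set, so feasibility of the policy suffices.
  Its actions may differ from \<open>p 0\<close> and \<open>p 1\<close> in a state of mass
  zero.\<close>

lemma zero_budget_optimal:
  assumes "0 \<le> \<gamma>" "\<gamma> < 1" "0 \<le> d 0" "0 \<le> d 1" "d 0 + d 1 = 1" "a0 \<in> {0..1}" "a1 \<in> {0..1}"
    and "p 0 \<in> {0..1}" "p 1 \<in> {0..1}"
    and "policy_mass0 \<gamma> d a0 a1 * \<bar>a0 - p 0\<bar> + (1 - policy_mass0 \<gamma> d a0 a1) * \<bar>a1 - p 1\<bar> \<le> 0"
  shows "optimal_policy \<gamma> d p 0 a0 a1"
  using zero_budget_objective[of \<gamma> d p] policy_feasible_iff[of \<gamma> d a0 a1 p 0] assms
  by (simp add: optimal_policy_def P1_optimal_def)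

text \<open>The last two hypotheses say that \<open>c - logit a\<close> is a subgradient of \<open>x \<mapsto> l * \<bar>x - q\<bar>\<close> at \<open>a\<close>.\<close>

lemma stationary_imp_max:
  assumes "0 < a" "a < 1" "x \<in> {0..1}"
    and "\<bar>c - logit a\<bar> \<le> l" "(c - logit a) * (a - q) = l * \<bar>a - q\<bar>"
  shows "bin_entropy x - l * \<bar>x - q\<bar> + c * x \<le> bin_entropy a - l * \<bar>a - q\<bar> + c * a"
proof -
  \<comment> \<open>The subgradient inequality, with equality at \<open>x = a\<close>; adding the
    tangent bound of the entropy gives the claim.\<close>
  have "(c - logit a) * (x - q) \<le> \<bar>c - logit a\<bar> * \<bar>x - q\<bar>"
    by (metis abs_ge_self abs_mult)
  also have "\<dots> \<le> l * \<bar>x - q\<bar>"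
    using assms by (intro mult_right_mono) auto
  finally show ?thesis
    using bin_entropy_le_tangent[OF assms(3,1,2)] assms(5) by (simp add: algebra_simps)
qed

text \<open>The KKT conditions: \<open>stat0\<close> and \<open>stat1\<close> make each action
  maximize the Lagrangian in its state, \<open>eq_val\<close> lets one \<open>\<nu>\<close> serve
  both states, and \<open>budget\<close> is feasibility with complementary slackness. The separate
  \<open>c\<close> covers both a tight budget and \<open>l = 0\<close>.\<close>

lemma stationary_imp_optimal:
  assumes "0 \<le> \<gamma>" "\<gamma> < 1" "0 \<le> d 0" "0 \<le> d 1" "d 0 + d 1 = 1"
    and a: "0 < a0" "a0 < 1" "0 < a1" "a1 < 1" and "0 \<le> l"
    and stat0: "\<bar>\<mu> * \<gamma> - logit a0\<bar> \<le> l" "(\<mu> * \<gamma> - logit a0) * (a0 - p 0) = l * \<bar>a0 - p 0\<bar>"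
    and stat1: "\<bar>\<mu> * \<gamma> - logit a1\<bar> \<le> l" "(\<mu> * \<gamma> - logit a1) * (a1 - p 1) = l * \<bar>a1 - p 1\<bar>"
    and eq_val: "bin_entropy a0 - l * \<bar>a0 - p 0\<bar> + \<mu> * \<gamma> * a0 - \<mu> =
      bin_entropy a1 - l * \<bar>a1 - p 1\<bar> + \<mu> * \<gamma> * a1"
    and cost: "policy_mass0 \<gamma> d a0 a1 * \<bar>a0 - p 0\<bar> +
      (1 - policy_mass0 \<gamma> d a0 a1) * \<bar>a1 - p 1\<bar> = c"
    and budget: "c \<le> b / 2" "l * c = l * (b / 2)"
  shows "optimal_policy \<gamma> d p b a0 a1"
proof -
  define m where "m = policy_mass0 \<gamma> d a0 a1"
  define \<nu> where "\<nu> = bin_entropy a1 - l * \<bar>a1 - p 1\<bar> + \<mu> * \<gamma> * a1"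
  have in01: "a0 \<in> {0..1}" "a1 \<in> {0..1}" using a by auto
  have "m * (1 - \<gamma> * a0 + \<gamma> * a1) = disc_init \<gamma> d 0 + \<gamma> * a1"
    using policy_denominator_pos[of \<gamma> a0 a1] in01 assms(1,2) by (simp add: m_def policy_mass0_def)
  then have balance: "disc_init \<gamma> d 0 = m - \<gamma> * (m * a0 + (1 - m) * a1)"
    by (simp add: algebra_simps)
  have "P1_objective D \<le> m * bin_entropy a0 + (1 - m) * bin_entropy a1"
    if feas: "P1_feasible \<gamma> d p b D" for D
  proof -
    have "P1_objective D \<le> l * (b / 2) + \<mu> * disc_init \<gamma> d 0 + \<nu>"
    proof (rule P1_weak_duality[OF feas])
      fix s :: nat and x :: real
      assume "s \<in> {0, 1}" and x: "x \<in> {0..1}"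
      then show "bin_entropy x \<le> l * \<bar>x - p s\<bar> - \<mu> * \<gamma> * x + (if s = 0 then \<mu> else 0) + \<nu>"
        using stationary_imp_max[OF a(1,2) x stat0] stationary_imp_max[OF a(3,4) x stat1] eq_val
        by (auto simp: \<nu>_def)
    qed (use assms in auto)
    also have "\<dots> = l * c + \<mu> * disc_init \<gamma> d 0 + \<nu>"
      by (simp only: budget(2))
    \<comment> \<open>The inner parentheses are the slacks of the dual constraints at the chosen
      actions; both are zero by \<open>eq_val\<close> and the choice of
      \<open>\<nu>\<close>.\<close>
    also have "\<dots> = m * (bin_entropy a0 - (bin_entropy a0 - l * \<bar>a0 - p 0\<bar> + \<mu> * \<gamma> * a0 - \<mu> - \<nu>))
        + (1 - m) * (bin_entropy a1 - (bin_entropy a1 - l * \<bar>a1 - p 1\<bar> + \<mu> * \<gamma> * a1 - \<nu>))"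
      unfolding balance cost[folded m_def, symmetric] by (simp add: algebra_simps)
    also have "\<dots> = m * bin_entropy a0 + (1 - m) * bin_entropy a1"
      using eq_val by (simp add: \<nu>_def)
    finally show ?thesis .
  qed
  then show ?thesis
    using policy_feasible_iff[of \<gamma> d a0 a1 p b] policy_objective[of \<gamma> d a0 a1] assms in01
    by (simp add: optimal_policy_def P1_optimal_def m_def)
qed

section \<open>The three budget regimes\<close>

text \<open>The uniform action maximizes the entropy without constraints, so \<open>l\<close> and
  \<open>\<mu>\<close> vanish; \<open>b_high\<close> is exactly its total TV cost.\<close>

lemma optimal_large_budget:
  assumes "0 \<le> \<gamma>" "\<gamma> < 1" "0 \<le> d 0" "0 \<le> d 1" "d 0 + d 1 = 1"
    and "1/2 \<le> p 0" "1/2 \<le> p 1" and b: "b_high \<gamma> d p \<le> b"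
  shows "optimal_policy \<gamma> d p b (1/2) (1/2)"
proof (rule stationary_imp_optimal[where l = 0 and \<mu> = 0, OF assms(1-5) _ _ _ _ _ _ _ _ _ _ refl])
  have m: "policy_mass0 \<gamma> d (1/2) (1/2) = disc_init \<gamma> d 0 + \<gamma> / 2"
    by (simp add: policy_mass0_def)
  have "\<bar>1/2 - p 0\<bar> = p 0 - 1/2" "\<bar>1/2 - p 1\<bar> = p 1 - 1/2"
    using assms by auto
  then show "policy_mass0 \<gamma> d (1/2) (1/2) * \<bar>1/2 - p 0\<bar> +
      (1 - policy_mass0 \<gamma> d (1/2) (1/2)) * \<bar>1/2 - p 1\<bar> \<le> b / 2"
    unfolding m using b by (simp add: b_high_def algebra_simps)
qed (simp_all add: logit_def)

text \<open>The action \<open>a\<close> is the common action below both defaults that spends the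
  whole budget. With equal actions the entropy terms of \<open>eq_val\<close> cancel, leaving linear
  equations for the multipliers.\<close>

lemma optimal_common_action:
  fixes \<gamma> b :: real and d p :: "nat \<Rightarrow> real"
  assumes \<gamma>: "0 \<le> \<gamma>" "\<gamma> < 1" and d: "0 \<le> d 0" "0 \<le> d 1" "d 0 + d 1 = 1"
    and p: "p 0 \<in> {0..1}" "p 1 \<in> {0..1}" and "0 \<le> b"
    and b: "b_low \<gamma> d p \<le> b" "b < b_high \<gamma> d p"
  defines "a \<equiv> - M_coeff \<gamma> p * (b / 2 - disc_init \<gamma> d 0 * p 0 - (1 - disc_init \<gamma> d 0) * p 1)"
  shows "optimal_policy \<gamma> d p b a a"
proof -
  define \<delta> where "\<delta> = disc_init \<gamma> d 0"
  define N where "N = 1 - \<gamma> * p 0 + \<gamma> * p 1"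
  have N: "0 < N"
    using policy_denominator_pos[of \<gamma> "p 0" "p 1"] \<gamma> p by (simp add: N_def)
  have a_eq: "a = (\<delta> * p 0 + (1 - \<delta>) * p 1 - b / 2) / N"
    unfolding a_def M_coeff_def \<delta>_def[symmetric] N_def[symmetric]
    using N by (simp add: field_simps)
  then have aN: "a * N = \<delta> * p 0 + (1 - \<delta>) * p 1 - b / 2"
    using N by simp
  \<comment> \<open>The first entry of the maximum in \<open>b_low\<close> yields
    \<open>a \<le> p 0\<close>, the second \<open>a \<le> p 1\<close>; \<open>b_high\<close> yields
    \<open>1/2 \<le> a\<close>.\<close>
  have "a * N \<le> p 0 * N"
    unfolding aN using b(1) unfolding b_low_def N_def \<delta>_def by (simp add: algebra_simps max_def split: if_splits)
  then have a_p0: "a \<le> p 0" using N by simp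
  have "a * N \<le> p 1 * N"
    unfolding aN using b(1) unfolding b_low_def N_def \<delta>_def by (simp add: algebra_simps max_def split: if_splits)
  then have a_p1: "a \<le> p 1" using N by simp
  have "1/2 * N \<le> a * N"
    unfolding aN using b(2) unfolding b_high_def N_def \<delta>_def by (simp add: algebra_simps)
  then have a_half: "1/2 \<le> a" using N by simp
  have m: "policy_mass0 \<gamma> d a a = \<delta> + \<gamma> * a"
    by (simp add: policy_mass0_def \<delta>_def)
  \<comment> \<open>The terms quadratic in \<open>a\<close> cancel, so the cost is affine in
    \<open>a\<close> with slope \<open>- N\<close>.\<close>
  have "(\<delta> + \<gamma> * a) * (p 0 - a) + (1 - (\<delta> + \<gamma> * a)) * (p 1 - a) = \<delta> * p 0 + (1 - \<delta>) * p 1 - a * N"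
    by (simp add: N_def algebra_simps)
  then have cost: "policy_mass0 \<gamma> d a a * \<bar>a - p 0\<bar> + (1 - policy_mass0 \<gamma> d a a) * \<bar>a - p 1\<bar> = b / 2"
    using a_p0 a_p1 aN by (simp add: m)
  show ?thesis
  proof (cases "b = 0")
    case True
    show ?thesis
      unfolding True
      by (rule zero_budget_optimal) (use \<gamma> d p a_half a_p0 cost True in auto)
  next
    case False
    have "a < 1"
    proof (rule ccontr)
      assume "\<not> a < 1"
      then have "a = 1" "p 0 = 1" "p 1 = 1" using a_p0 a_p1 p by auto
      then show False using cost False by simp
    qed
    \<comment> \<open>Since \<open>a\<close> lies below both defaults, both subgradients are taken
      as \<open>- l\<close>. Equal state values force \<open>\<mu> = l * (p 1 - p 0)\<close>, and
      stationarity becomes \<open>l * N = logit a\<close>.\<close>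
    define l where "l = logit a / N"
    have l: "0 \<le> l" using logit_nonneg[OF a_half \<open>a < 1\<close>] N by (simp add: l_def)
    have "l * N = logit a" using N by (simp add: l_def)
    then have eq: "l * (p 1 - p 0) * \<gamma> - logit a = - l"
      by (simp add: N_def algebra_simps)
    have stat: "(l * (p 1 - p 0) * \<gamma> - logit a) * (a - q) = l * \<bar>a - q\<bar>" if "a \<le> q" for q
      unfolding eq using that by (simp add: algebra_simps)
    show ?thesis
    proof (rule stationary_imp_optimal[where l = l and \<mu> = "l * (p 1 - p 0)", OF \<gamma> d _ _ _ _ l _ _ _ _ _ cost])
      show "bin_entropy a - l * \<bar>a - p 0\<bar> + l * (p 1 - p 0) * \<gamma> * a - l * (p 1 - p 0) =
          bin_entropy a - l * \<bar>a - p 1\<bar> + l * (p 1 - p 0) * \<gamma> * a"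
        using a_p0 a_p1 by (simp add: algebra_simps)
    qed (use a_half \<open>a < 1\<close> stat[OF a_p0] stat[OF a_p1] eq l in auto)
  qed
qed

text \<open>State 0 keeps its default and the whole budget lowers the action of state 1;
  \<open>eta1_minus\<close> solves that cost equation. State 0 sits at the kink of the distance, so
  its stationarity is only an inequality.\<close>

lemma optimal_small_budget_less:
  fixes \<gamma> b :: real and d p :: "nat \<Rightarrow> real"
  assumes \<gamma>: "0 \<le> \<gamma>" "\<gamma> < 1" and d: "0 \<le> d 0" "0 \<le> d 1" "d 0 + d 1 = 1"
    and p: "p 0 \<in> {0..1}" "p 1 \<in> {0..1}" "1/2 \<le> p 0" "p 0 < p 1" and "0 \<le> b"
    and b: "b < 2 * ((1 - \<gamma> * p 0 - disc_init \<gamma> d 0) * (p 1 - p 0))"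
  shows "optimal_policy \<gamma> d p b (p 0) (eta1_minus \<gamma> d p b)"
proof -
  define a where "a = eta1_minus \<gamma> d p b"
  define w where "w = 1 - \<gamma> * p 0 - disc_init \<gamma> d 0"
  have "0 < w * (p 1 - p 0)" using b \<open>0 \<le> b\<close> by (simp add: w_def)
  then have w: "0 < w" using p by (simp add: zero_less_mult_iff)
  have W: "0 < w + \<gamma> * (b / 2)" using w \<gamma> \<open>0 \<le> b\<close> by (simp add: add_pos_nonneg)
  have "a = (p 1 * w - b / 2 * (1 - \<gamma> * p 0)) / (w + \<gamma> * (b / 2))"
  proof -
    have "a = (- (p 1 * w - b / 2 * (1 - \<gamma> * p 0))) / (- (w + \<gamma> * (b / 2)))"
      by (simp add: a_def eta1_minus_def w_def)
    then show ?thesis by (simp only: minus_divide_divide)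
  qed
  then have aW: "a * (w + \<gamma> * (b / 2)) = p 1 * w - b / 2 * (1 - \<gamma> * p 0)"
    using W by simp
  \<comment> \<open>The difference of the sides is \<open>w * (p 1 - p 0) - b / 2\<close>, so the
    bound on \<open>b\<close> keeps \<open>a\<close> above \<open>p 0\<close>.\<close>
  have "p 0 * (w + \<gamma> * (b / 2)) \<le> a * (w + \<gamma> * (b / 2))"
    unfolding aW using b unfolding w_def[symmetric] by (simp add: algebra_simps)
  then have a_p0: "p 0 \<le> a" using W by simp
  have N: "0 < 1 - \<gamma> * p 0 + \<gamma> * p 1"
    using policy_denominator_pos[of \<gamma> "p 0" "p 1"] \<gamma> p by simp
  have "p 1 * (w + \<gamma> * (b / 2)) - a * (w + \<gamma> * (b / 2)) = b / 2 * (1 - \<gamma> * p 0 + \<gamma> * p 1)"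
    unfolding aW by (simp add: algebra_simps)
  then have gap: "(p 1 - a) * (w + \<gamma> * (b / 2)) = b / 2 * (1 - \<gamma> * p 0 + \<gamma> * p 1)"
    by (simp add: left_diff_distrib)
  moreover have "0 \<le> b / 2 * (1 - \<gamma> * p 0 + \<gamma> * p 1)" using N \<open>0 \<le> b\<close> by simp
  ultimately have a_p1: "a \<le> p 1" using W by (metis diff_ge_0_iff_ge not_less zero_le_mult_iff)
  have den: "0 < 1 - \<gamma> * p 0 + \<gamma> * a"
    using policy_denominator_pos[of \<gamma> "p 0" a] \<gamma> p a_p0 a_p1 by auto
  have mass: "1 - policy_mass0 \<gamma> d (p 0) a = w / (1 - \<gamma> * p 0 + \<gamma> * a)"
    using den by (simp add: policy_mass0_def w_def field_simps)
  have "w * (p 1 - a) = b / 2 * (1 - \<gamma> * p 0 + \<gamma> * a)"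
    using aW by (simp add: algebra_simps)
  then have "(1 - policy_mass0 \<gamma> d (p 0) a) * (p 1 - a) = b / 2"
    unfolding mass times_divide_eq_left using den by simp
  then have cost: "policy_mass0 \<gamma> d (p 0) a * \<bar>p 0 - p 0\<bar> +
      (1 - policy_mass0 \<gamma> d (p 0) a) * \<bar>a - p 1\<bar> = b / 2"
    using a_p1 by simp
  have "optimal_policy \<gamma> d p b (p 0) a"
  proof (cases "b = 0")
    case True
    show ?thesis
      unfolding True
      by (rule zero_budget_optimal) (use \<gamma> d p a_p0 a_p1 cost True in auto)
  next
    case False
    with gap N \<open>0 \<le> b\<close> have "a \<noteq> p 1" by auto
    then have "a < 1" using a_p1 p by auto
    \<comment> \<open>State 1 lies below its kink, which gives
      \<open>l = logit a - \<mu> * \<gamma>\<close>; substituting this into the equality of state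
      values and solving for \<open>\<mu>\<close> gives the quotient.\<close>
    define \<mu> where "\<mu> = (bin_entropy (p 0) - bin_entropy a + logit a * (p 1 - a)) /
      (1 - \<gamma> * p 0 + \<gamma> * p 1)"
    define l where "l = logit a - \<mu> * \<gamma>"
    have \<mu>N: "\<mu> * (1 - \<gamma> * p 0 + \<gamma> * p 1) = bin_entropy (p 0) - bin_entropy a + logit a * (p 1 - a)"
      using N by (simp add: \<mu>_def)
    have logit: "0 \<le> logit (p 0)" "0 \<le> logit a" "logit (p 0) \<le> logit a"
      using p a_p0 \<open>a < 1\<close> by (auto intro!: logit_nonneg logit_mono)
    \<comment> \<open>The kink condition in state 0 needs
      \<open>2 * (\<mu> * \<gamma>) \<le> logit a + logit (p 0)\<close>. The tangent at
      \<open>a\<close> bounds \<open>\<mu>\<close>, and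
      \<open>\<gamma> * (p 1 - p 0) \<le> 1\<close> supplies the factor 2.\<close>
    have "bin_entropy (p 0) \<le> bin_entropy a - logit a * (p 0 - a)"
      using p a_p0 \<open>a < 1\<close> by (intro bin_entropy_le_tangent) auto
    then have "\<mu> * (1 - \<gamma> * p 0 + \<gamma> * p 1) \<le> logit a * (p 1 - p 0)"
      unfolding \<mu>N by (simp add: algebra_simps)
    then have "\<gamma> * (\<mu> * (1 - \<gamma> * p 0 + \<gamma> * p 1)) \<le> \<gamma> * (logit a * (p 1 - p 0))"
      using \<gamma> by (intro mult_left_mono)
    moreover have "\<gamma> * (p 1 - p 0) \<le> 1"
      using mult_mono[of \<gamma> 1 "p 1 - p 0" 1] \<gamma> p by auto
    then have "logit a * (2 * (\<gamma> * (p 1 - p 0))) \<le> logit a * (1 - \<gamma> * p 0 + \<gamma> * p 1)"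
      using logit by (intro mult_left_mono) (auto simp: algebra_simps)
    ultimately have "(2 * (\<mu> * \<gamma>)) * (1 - \<gamma> * p 0 + \<gamma> * p 1) \<le> logit a * (1 - \<gamma> * p 0 + \<gamma> * p 1)"
      by (simp add: algebra_simps)
    then have \<mu>_upper: "2 * (\<mu> * \<gamma>) \<le> logit a"
      using N by simp
    have "bin_entropy a \<le> bin_entropy (p 0) - logit (p 0) * (a - p 0)"
      using p a_p0 a_p1 \<open>a < 1\<close> by (intro bin_entropy_le_tangent) auto
    moreover have "0 \<le> logit (p 0) * (a - p 0)" "0 \<le> logit a * (p 1 - a)"
      using logit a_p0 a_p1 by auto
    ultimately have "0 \<le> \<mu>"
      unfolding \<mu>_def using N by (intro divide_nonneg_nonneg) linarith+
    then have \<mu>\<gamma>: "0 \<le> \<mu> * \<gamma>" using \<gamma> by simp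
    show ?thesis
    proof (rule stationary_imp_optimal[where l = l and \<mu> = \<mu>, OF \<gamma> d _ _ _ _ _ _ _ _ _ _ cost])
      show "0 \<le> l" "\<bar>\<mu> * \<gamma> - logit (p 0)\<bar> \<le> l" "\<bar>\<mu> * \<gamma> - logit a\<bar> \<le> l"
        using \<mu>_upper \<mu>\<gamma> logit by (auto simp: l_def)
      show "(\<mu> * \<gamma> - logit a) * (a - p 1) = l * \<bar>a - p 1\<bar>"
        using a_p1 by (simp add: l_def algebra_simps)
      show "bin_entropy (p 0) - l * \<bar>p 0 - p 0\<bar> + \<mu> * \<gamma> * p 0 - \<mu> =
          bin_entropy a - l * \<bar>a - p 1\<bar> + \<mu> * \<gamma> * a"
        using \<mu>N a_p1 by (simp add: l_def algebra_simps)
    qed (use p a_p0 \<open>a < 1\<close> in auto)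
  qed
  then show ?thesis by (simp add: a_def)
qed

text \<open>The mirror case: state 1 stays at its kink and state 0 spends the budget.\<close>

lemma optimal_small_budget_greater:
  fixes \<gamma> b :: real and d p :: "nat \<Rightarrow> real"
  assumes \<gamma>: "0 \<le> \<gamma>" "\<gamma> < 1" and d: "0 \<le> d 0" "0 \<le> d 1" "d 0 + d 1 = 1"
    and p: "p 0 \<in> {0..1}" "p 1 \<in> {0..1}" "1/2 \<le> p 1" "p 1 < p 0" and "0 \<le> b"
    and b: "b < 2 * ((disc_init \<gamma> d 0 + \<gamma> * p 1) * (p 0 - p 1))"
  shows "optimal_policy \<gamma> d p b (eta0_minus \<gamma> d p b) (p 1)"
proof -
  define a where "a = eta0_minus \<gamma> d p b"
  define w where "w = disc_init \<gamma> d 0 + \<gamma> * p 1"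
  have "0 < w * (p 0 - p 1)" using b \<open>0 \<le> b\<close> by (simp add: w_def)
  then have w: "0 < w" using p by (simp add: zero_less_mult_iff)
  have N: "0 < 1 - \<gamma> * p 0 + \<gamma> * p 1"
    using policy_denominator_pos[of \<gamma> "p 0" "p 1"] \<gamma> p by simp
  \<comment> \<open>Here the budget term is subtracted in the denominator, so its sign rests on the
    upper bound for \<open>b\<close>.\<close>
  have "\<gamma> * (b / 2) \<le> 1 * (b / 2)" using \<gamma> \<open>0 \<le> b\<close> by (intro mult_right_mono) auto
  also have "\<dots> < w * (p 0 - p 1)" using b by (simp add: w_def)
  also have "\<dots> \<le> w * 1" using w p by (intro mult_left_mono) auto
  finally have W: "0 < w - \<gamma> * (b / 2)" by simp
  have "a = (p 0 * w - b / 2 * (1 + \<gamma> * p 1)) / (w - \<gamma> * (b / 2))"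
  proof -
    have "a = (- (p 0 * w - b / 2 * (1 + \<gamma> * p 1))) / (- (w - \<gamma> * (b / 2)))"
      by (simp add: a_def eta0_minus_def w_def algebra_simps)
    then show ?thesis by (simp only: minus_divide_divide)
  qed
  then have aW: "a * (w - \<gamma> * (b / 2)) = p 0 * w - b / 2 * (1 + \<gamma> * p 1)"
    using W by simp
  have "p 1 * (w - \<gamma> * (b / 2)) \<le> a * (w - \<gamma> * (b / 2))"
    unfolding aW using b unfolding w_def[symmetric] by (simp add: algebra_simps)
  then have a_p1: "p 1 \<le> a" using W by simp
  have "p 0 * (w - \<gamma> * (b / 2)) - a * (w - \<gamma> * (b / 2)) = b / 2 * (1 - \<gamma> * p 0 + \<gamma> * p 1)"
    unfolding aW by (simp add: algebra_simps)
  then have gap: "(p 0 - a) * (w - \<gamma> * (b / 2)) = b / 2 * (1 - \<gamma> * p 0 + \<gamma> * p 1)"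
    by (simp add: left_diff_distrib)
  moreover have "0 \<le> b / 2 * (1 - \<gamma> * p 0 + \<gamma> * p 1)" using N \<open>0 \<le> b\<close> by simp
  ultimately have a_p0: "a \<le> p 0" using W by (metis diff_ge_0_iff_ge not_less zero_le_mult_iff)
  have den: "0 < 1 - \<gamma> * a + \<gamma> * p 1"
    using policy_denominator_pos[of \<gamma> a "p 1"] \<gamma> p a_p0 a_p1 by auto
  have mass: "policy_mass0 \<gamma> d a (p 1) = w / (1 - \<gamma> * a + \<gamma> * p 1)"
    by (simp add: policy_mass0_def w_def)
  have "w * (p 0 - a) = b / 2 * (1 - \<gamma> * a + \<gamma> * p 1)"
    using aW by (simp add: algebra_simps)
  then have "(policy_mass0 \<gamma> d a (p 1)) * (p 0 - a) = b / 2"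
    unfolding mass times_divide_eq_left using den by simp
  then have cost: "policy_mass0 \<gamma> d a (p 1) * \<bar>a - p 0\<bar> +
      (1 - policy_mass0 \<gamma> d a (p 1)) * \<bar>p 1 - p 1\<bar> = b / 2"
    using a_p0 by simp
  have "optimal_policy \<gamma> d p b a (p 1)"
  proof (cases "b = 0")
    case True
    show ?thesis
      unfolding True
      by (rule zero_budget_optimal) (use \<gamma> d p a_p0 a_p1 cost True in auto)
  next
    case False
    with gap N \<open>0 \<le> b\<close> have "a \<noteq> p 0" by auto
    then have "a < 1" using a_p0 p by auto
    define \<mu> where "\<mu> = (bin_entropy a - bin_entropy (p 1) - logit a * (p 0 - a)) /
      (1 - \<gamma> * p 0 + \<gamma> * p 1)"
    define l where "l = logit a - \<mu> * \<gamma>"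
    have \<mu>N: "\<mu> * (1 - \<gamma> * p 0 + \<gamma> * p 1) = bin_entropy a - bin_entropy (p 1) - logit a * (p 0 - a)"
      using N by (simp add: \<mu>_def)
    have logit: "0 \<le> logit (p 1)" "0 \<le> logit a" "logit (p 1) \<le> logit a"
      using p a_p1 \<open>a < 1\<close> by (auto intro!: logit_nonneg logit_mono)
    have "bin_entropy a \<le> bin_entropy (p 1) - logit (p 1) * (a - p 1)"
      using p a_p0 a_p1 \<open>a < 1\<close> by (intro bin_entropy_le_tangent) auto
    moreover have "0 \<le> logit (p 1) * (a - p 1)" "0 \<le> logit a * (p 0 - a)"
      using logit a_p0 a_p1 by auto
    \<comment> \<open>With this sign the kink condition in state 1 reduces to monotonicity of
      \<open>logit\<close>.\<close>
    ultimately have "\<mu> \<le> 0"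
      unfolding \<mu>_def using N by (intro divide_nonpos_nonneg) linarith+
    then have \<mu>\<gamma>: "\<mu> * \<gamma> \<le> 0" using \<gamma> by (simp add: mult_nonpos_nonneg)
    show ?thesis
    proof (rule stationary_imp_optimal[where l = l and \<mu> = \<mu>, OF \<gamma> d _ _ _ _ _ _ _ _ _ _ cost])
      show "0 \<le> l" "\<bar>\<mu> * \<gamma> - logit a\<bar> \<le> l" "\<bar>\<mu> * \<gamma> - logit (p 1)\<bar> \<le> l"
        using \<mu>\<gamma> logit by (auto simp: l_def)
      show "(\<mu> * \<gamma> - logit a) * (a - p 0) = l * \<bar>a - p 0\<bar>"
        using a_p0 by (simp add: l_def algebra_simps)
      show "bin_entropy a - l * \<bar>a - p 0\<bar> + \<mu> * \<gamma> * a - \<mu> =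
          bin_entropy (p 1) - l * \<bar>p 1 - p 1\<bar> + \<mu> * \<gamma> * p 1"
        using \<mu>N a_p0 by (simp add: l_def algebra_simps)
    qed (use p a_p1 \<open>a < 1\<close> in auto)
  qed
  then show ?thesis by (simp add: a_def)
qed

text \<open>The factors besides the differences of \<open>p\<close> are nonnegative, being
  numerators of the state masses under the defaults. Hence the ordering of \<open>p 0\<close> and
  \<open>p 1\<close> decides the maximum.\<close>

lemma b_low_cases:
  assumes "0 \<le> \<gamma>" "\<gamma> < 1" "0 \<le> d 0" "0 \<le> d 1" "d 0 + d 1 = 1" "p 0 \<in> {0..1}" "p 1 \<in> {0..1}"
  shows "p 0 \<le> p 1 \<Longrightarrow> b_low \<gamma> d p = 2 * ((1 - \<gamma> * p 0 - disc_init \<gamma> d 0) * (p 1 - p 0))"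
    and "p 1 \<le> p 0 \<Longrightarrow> b_low \<gamma> d p = 2 * ((disc_init \<gamma> d 0 + \<gamma> * p 1) * (p 0 - p 1))"
proof -
  have "\<gamma> * p 0 \<le> \<gamma>" "0 \<le> \<gamma> * p 1" "(1 - \<gamma>) * d 0 \<le> 1 - \<gamma>" "0 \<le> (1 - \<gamma>) * d 0"
    using assms by (auto simp: mult_left_le)
  then have w: "0 \<le> 1 - \<gamma> * p 0 - disc_init \<gamma> d 0" "0 \<le> disc_init \<gamma> d 0 + \<gamma> * p 1"
    by (auto simp: disc_init_def)
  show "b_low \<gamma> d p = 2 * ((1 - \<gamma> * p 0 - disc_init \<gamma> d 0) * (p 1 - p 0))" if "p 0 \<le> p 1"
  proof -
    have "(disc_init \<gamma> d 0 + \<gamma> * p 1) * (p 0 - p 1) \<le> 0"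
      using that w by (intro mult_nonneg_nonpos) auto
    also have "0 \<le> (1 - \<gamma> * p 0 - disc_init \<gamma> d 0) * (p 1 - p 0)"
      using that w by (intro mult_nonneg_nonneg) auto
    finally show ?thesis
      by (simp only: b_low_def max_absorb1)
  qed
  show "b_low \<gamma> d p = 2 * ((disc_init \<gamma> d 0 + \<gamma> * p 1) * (p 0 - p 1))" if "p 1 \<le> p 0"
  proof -
    have "(1 - \<gamma> * p 0 - disc_init \<gamma> d 0) * (p 1 - p 0) \<le> 0"
      using that w by (intro mult_nonneg_nonpos) auto
    also have "0 \<le> (disc_init \<gamma> d 0 + \<gamma> * p 1) * (p 0 - p 1)"
      using that w by (intro mult_nonneg_nonneg) auto
    finally show ?thesis
      by (simp only: b_low_def max_absorb2)
  qed
qed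

section \<open>Case distinction over the budget\<close>

theorem theorem2:
  fixes \<gamma> b :: real and d p :: "nat \<Rightarrow> real"
  assumes "0 \<le> \<gamma>" and "\<gamma> < 1"
    and "0 \<le> d 0" and "0 \<le> d 1" and "d 0 + d 1 = 1"
    and "p 0 \<in> {0..1}" and "p 1 \<in> {0..1}"
    and "1/2 \<le> p 0" and "1/2 \<le> p 1"
    and "0 \<le> b"
  shows
    "(b \<in> {0..<b_low \<gamma> d p} \<longrightarrow>
        (\<bar>1/2 - p 1\<bar> \<ge> \<bar>1/2 - p 0\<bar> \<longrightarrow>
           optimal_policy \<gamma> d p b (p 0) (eta1_minus \<gamma> d p b)) \<and>
        (\<bar>1/2 - p 1\<bar> < \<bar>1/2 - p 0\<bar> \<longrightarrow>
           optimal_policy \<gamma> d p b (eta0_minus \<gamma> d p b) (p 1))) \<and>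
     (b \<in> {b_low \<gamma> d p..<b_high \<gamma> d p} \<longrightarrow>
        optimal_policy \<gamma> d p b
          (- M_coeff \<gamma> p * (b / 2 - disc_init \<gamma> d 0 * p 0 - (1 - disc_init \<gamma> d 0) * p 1))
          (- M_coeff \<gamma> p * (b / 2 - disc_init \<gamma> d 0 * p 0 - (1 - disc_init \<gamma> d 0) * p 1))) \<and>
     (b \<in> {b_high \<gamma> d p..} \<longrightarrow> optimal_policy \<gamma> d p b (1/2) (1/2))"
proof (intro conjI impI)
  assume b: "b \<in> {0..<b_low \<gamma> d p}" and "\<bar>1/2 - p 1\<bar> \<ge> \<bar>1/2 - p 0\<bar>"
  \<comment> \<open>Both defaults are at least 1/2, so comparing distances to 1/2 compares the
    defaults.\<close>
  then have le: "p 0 \<le> p 1" using assms by auto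
  \<comment> \<open>Equal defaults give \<open>b_low = 0\<close> and an empty budget range.\<close>
  have "p 0 \<noteq> p 1" using b by (auto simp: b_low_def)
  with le b_low_cases(1)[OF assms(1-7) le] b
  show "optimal_policy \<gamma> d p b (p 0) (eta1_minus \<gamma> d p b)"
    by (intro optimal_small_budget_less) (use assms in auto)
next
  assume b: "b \<in> {0..<b_low \<gamma> d p}" and "\<bar>1/2 - p 1\<bar> < \<bar>1/2 - p 0\<bar>"
  then have "p 1 < p 0" using assms by auto
  with b_low_cases(2)[OF assms(1-7)] b
  show "optimal_policy \<gamma> d p b (eta0_minus \<gamma> d p b) (p 1)"
    by (intro optimal_small_budget_greater) (use assms in auto)
next
  assume "b \<in> {b_low \<gamma> d p..<b_high \<gamma> d p}"
  then show "optimal_policy \<gamma> d p b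
      (- M_coeff \<gamma> p * (b / 2 - disc_init \<gamma> d 0 * p 0 - (1 - disc_init \<gamma> d 0) * p 1))
      (- M_coeff \<gamma> p * (b / 2 - disc_init \<gamma> d 0 * p 0 - (1 - disc_init \<gamma> d 0) * p 1))"
    by (intro optimal_common_action) (use assms in auto)
next
  assume "b \<in> {b_high \<gamma> d p..}"
  then show "optimal_policy \<gamma> d p b (1/2) (1/2)"
    by (intro optimal_large_budget) (use assms in auto)
qed

end
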